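(* Let $\lambda=(L_1^{m_1},\dots,L_r^{m_r})$ be a partition written in compressed form with gaps $g_1,\dots,g_r$, and let $S_i:=m_1+\cdots+m_i$ for $1\le i\le r$. Then the conjugate partition $\lambda'$ has compressed form $$\lambda'=(S_r^{g_r},\,S_{r-1}^{g_{r-1}},\,\dots,\,S_1^{g_1}).$$ Consequently, $A(\lambda')=B(\lambda)$ and $B(\lambda')=A(\lambda)$.
   Context: Compressed form: a partition $\lambda$ is written $\lambda=(L_1^{m_1},\dots,L_r^{m_r})$ with $L_1>\cdots>L_r>0$ its distinct part sizes and $m_i\ge 1$ the multiplicity of $L_i$. Gaps: $g_i=L_i-L_{i+1}$ for $1\le i<r$ and $g_r=L_r$. Set $A(\lambda):=\#\{i:g_i>1\}$ and $B(\lambda):=\#\{i:m_i>1\}$. The conjugate $\lambda'$ is the partition whose Ferrers diagram is the transpose of that of $\lambda$. *)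

theory Defs
  imports Main
begin

definition is_partition :: "nat list \<Rightarrow> bool" where
  "is_partition lam \<longleftrightarrow> sorted_wrt (\<ge>) lam \<and> 0 \<notin> set lam"

text \<open>Rows and columns of the diagram are numbered from 0.\<close>

definition ferrers :: "nat list \<Rightarrow> (nat \<times> nat) set" where
  "ferrers lam = {(i, j). i < length lam \<and> j < lam ! i}"

text \<open>The description is proper on partitions: see \<open>ex1_conjugate\<close> below.\<close>

definition conjugate :: "nat list \<Rightarrow> nat list" where
  "conjugate lam = (THE mu. is_partition mu \<and> ferrers mu = (ferrers lam)\<inverse>)"

text \<open>
  \<open>compressed_form lam r L m\<close> says that \<open>lam = (L 1 ^ m 1, \<dots>, L r ^ m r)\<close> is the compressed
  form of \<open>lam\<close>; the values of \<open>L\<close> and \<open>m\<close> outside \<open>{1..r}\<close> play no role. The empty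
  partition is the case \<open>r = 0\<close>.
\<close>

definition compressed_form ::
    "nat list \<Rightarrow> nat \<Rightarrow> (nat \<Rightarrow> nat) \<Rightarrow> (nat \<Rightarrow> nat) \<Rightarrow> bool" where
  "compressed_form lam r L m \<longleftrightarrow>
     (\<forall>i\<in>{1..<r}. L i > L (i + 1)) \<and>
     (\<forall>i\<in>{1..r}. L i > 0 \<and> m i \<ge> 1) \<and>
     lam = concat (map (\<lambda>i. replicate (m i) (L i)) [1..<r + 1])"

definition gap :: "nat \<Rightarrow> (nat \<Rightarrow> nat) \<Rightarrow> nat \<Rightarrow> nat" where
  "gap r L i = (if i < r then L i - L (i + 1) else L r)"

text \<open>
  The data \<open>r\<close>, \<open>L\<^sub>i\<close>, \<open>m\<^sub>i\<close> of the compressed form, read off from the partition; \<open>i\<close> ranges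
  over \<open>{1..num_sizes lam}\<close>. By \<open>compressed_form_canonical\<close> and \<open>compressed_form_unique\<close>
  below, they constitute the one and only compressed form of \<open>lam\<close>.
\<close>

definition num_sizes :: "nat list \<Rightarrow> nat" where
  "num_sizes lam = card (set lam)"

definition part_size :: "nat list \<Rightarrow> nat \<Rightarrow> nat" where
  "part_size lam i = rev (sorted_list_of_set (set lam)) ! (i - 1)"

definition multiplicity_of :: "nat list \<Rightarrow> nat \<Rightarrow> nat" where
  "multiplicity_of lam i = count_list lam (part_size lam i)"

definition A :: "nat list \<Rightarrow> nat" where
  "A lam = card {i \<in> {1..num_sizes lam}. gap (num_sizes lam) (part_size lam) i > 1}"

definition B :: "nat list \<Rightarrow> nat" where
  "B lam = card {i \<in> {1..num_sizes lam}. multiplicity_of lam i > 1}"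

lemma ferrers_inject:
  assumes "is_partition xs" "is_partition ys" "ferrers xs = ferrers ys"
  shows "xs = ys"
proof -
  have len: "i < length zs \<longleftrightarrow> (i, 0) \<in> ferrers zs" if "is_partition zs" for zs i
    using that by (auto simp: is_partition_def ferrers_def) (metis gr0I nth_mem)
  have l: "length xs = length ys"
    using len[OF assms(1)] len[OF assms(2)] assms(3) by (metis linorder_neqE_nat less_irrefl)
  show ?thesis
  proof (rule nth_equalityI[OF l])
    fix i assume i: "i < length xs"
    have "j < xs ! i \<longleftrightarrow> j < ys ! i" for j
    proof -
      have "(i, j) \<in> ferrers xs \<longleftrightarrow> (i, j) \<in> ferrers ys" using assms(3) by simp
      then show ?thesis using i l by (simp add: ferrers_def)
    qed
    then show "xs ! i = ys ! i" by (metis linorder_neqE_nat less_irrefl)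
  qed
qed

lemma ex1_conjugate:
  assumes "is_partition lam"
  shows "\<exists>!mu. is_partition mu \<and> ferrers mu = (ferrers lam)\<inverse>"
proof (rule ex_ex1I)
  let ?C = "\<lambda>j. {i. i < length lam \<and> j < lam ! i}"
  define N where "N = (if lam = [] then 0 else lam ! 0)"
  define mu where "mu = map (\<lambda>j. card (?C j)) [0..<N]"
  have mono: "lam ! i \<ge> lam ! k" if "i \<le> k" "k < length lam" for i k
    using assms that by (cases "i = k") (auto simp: is_partition_def sorted_wrt_iff_nth_less)
  have fin: "finite (?C j)" for j by simp
  have C: "i \<in> ?C j \<longleftrightarrow> i < card (?C j)" for i j
  proof -
    have down: "{..<card (?C j)} = ?C j"
    proof -
      have d: "k \<in> ?C j" if "i \<in> ?C j" "k \<le> i" for i k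
        using that mono[of k i] by auto
      show ?thesis
      proof (cases "?C j = {}")
        case True then show ?thesis by (simp only: card.empty) simp
      next
        case False
        have "?C j = {..Max (?C j)}"
        proof
          show "?C j \<subseteq> {..Max (?C j)}" using Max_ge[OF fin] by blast
          show "{..Max (?C j)} \<subseteq> ?C j" using d[OF Max_in[OF fin False]] by blast
        qed
        then show ?thesis by (metis card_atMost lessThan_Suc_atMost)
      qed
    qed
    show ?thesis by (subst down[symmetric]) simp
  qed
  define D where "D j = card (?C j)" for j
  have D: "i < length lam \<and> j < lam ! i \<longleftrightarrow> i < D j" for i j
    using C[of i j] unfolding D_def by blast
  have N: "j < N" if "i < length lam" "j < lam ! i" for i j
    using that mono[of 0 i] by (auto simp: N_def)
  have len[simp]: "length mu = N" by (simp add: mu_def)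
  have nth[simp]: "mu ! j = D j" if "j < N" for j using that by (simp add: mu_def D_def)
  have "is_partition mu"
    unfolding is_partition_def
  proof
    show "sorted_wrt (\<ge>) mu"
      by (auto simp: sorted_wrt_iff_nth_less) (auto simp: D_def intro!: card_mono)
    show "0 \<notin> set mu"
    proof
      assume "0 \<in> set mu"
      then obtain j where j: "j < N" "D j = 0" by (auto simp: in_set_conv_nth)
      then have "0 < length lam \<and> j < lam ! 0" by (auto simp: N_def split: if_splits)
      then show False using j(2) D[of 0 j] by simp
    qed
  qed
  moreover have "ferrers mu = (ferrers lam)\<inverse>"
  proof -
    have "(j, i) \<in> ferrers mu \<longleftrightarrow> (i, j) \<in> ferrers lam" for i j
      using N[of i j] D[of i j] by (auto simp: ferrers_def)
    then show ?thesis by auto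
  qed
  ultimately show "\<exists>mu. is_partition mu \<and> ferrers mu = (ferrers lam)\<inverse>" by blast
qed (metis ferrers_inject)

lemma
  assumes "is_partition lam"
  shows is_partition_conjugate: "is_partition (conjugate lam)"
    and ferrers_conjugate: "ferrers (conjugate lam) = (ferrers lam)\<inverse>"
  using theI'[OF ex1_conjugate[OF assms]] by (simp_all add: conjugate_def)

lemma compressed_form_less:
  assumes "compressed_form lam r L m" "1 \<le> i" "i < j" "j \<le> r"
  shows "L i > L j"
  using assms(3,4)
proof (induction j)
  case (Suc j)
  have "L j > L (Suc j)" using assms(1,2) Suc.prems by (auto simp: compressed_form_def)
  then show ?case using Suc by (cases "i = j") auto
qed simp

lemma set_compressed_form:
  assumes "compressed_form lam r L m"
  shows "set lam = L ` {1..r}"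
  using assms unfolding compressed_form_def by force

lemma sorted_sizes_compressed_form:
  assumes "compressed_form lam r L m"
  shows "rev (sorted_list_of_set (set lam)) = map L [1..<r + 1]"
proof -
  have "sorted_wrt (<) (rev (map L [1..<r + 1]))"
    unfolding sorted_wrt_rev
    by (auto simp: sorted_wrt_iff_nth_less simp del: upt_Suc
             intro!: compressed_form_less[OF assms])
  moreover have "set (rev (map L [1..<r + 1])) = set lam"
    using set_compressed_form[OF assms] by auto
  ultimately have "sorted_list_of_set (set lam) = rev (map L [1..<r + 1])"
    by (metis sorted_list_of_set.idem_if_sorted_distinct strict_sorted_iff)
  then show ?thesis by simp
qed

lemma is_partition_append_replicate:
  assumes "is_partition xs" "x > 0" "\<forall>y\<in>set xs. y \<ge> x"
  shows "is_partition (xs @ replicate n x)"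
proof -
  have "sorted_wrt (\<ge>) (replicate n x)" by (induction n) auto
  then show ?thesis using assms by (auto simp: is_partition_def sorted_wrt_append)
qed

lemma is_partition_compressed_form:
  assumes "compressed_form lam r L m"
  shows "is_partition lam"
proof -
  have "is_partition (concat (map (\<lambda>i. replicate (m i) (L i)) [1..<k + 1]))" if "k \<le> r" for k
    using that
  proof (induction k)
    case (Suc k)
    have "L (Suc k) > 0" using assms Suc.prems by (auto simp: compressed_form_def)
    moreover have "L (Suc k) \<le> L i" if "1 \<le> i" "i \<le> k" for i
      using compressed_form_less[OF assms, of i "Suc k"] that Suc.prems by simp
    ultimately show ?case using Suc
      by (auto intro!: is_partition_append_replicate simp del: upt_Suc simp add: upt_Suc_append)
  qed (simp add: is_partition_def)
  then show ?thesis using assms unfolding compressed_form_def by blast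
qed

lemma compressed_form_unique:
  assumes "compressed_form lam r L m"
  shows "num_sizes lam = r"
    and "i \<in> {1..r} \<Longrightarrow> part_size lam i = L i"
    and "i \<in> {1..r} \<Longrightarrow> multiplicity_of lam i = m i"
proof -
  have inj: "L i = L j \<longleftrightarrow> i = j" if "i \<in> {1..r}" "j \<in> {1..r}" for i j
    using compressed_form_less[OF assms, of i j] compressed_form_less[OF assms, of j i] that
    by (metis atLeastAtMost_iff less_irrefl linorder_neqE_nat)
  show "num_sizes lam = r"
    unfolding num_sizes_def set_compressed_form[OF assms]
    using inj by (subst card_image) (auto simp: inj_on_def)
  have p: "part_size lam i = L i" if "i \<in> {1..r}" for i
    unfolding part_size_def sorted_sizes_compressed_form[OF assms]
    using that by (subst nth_map) (auto simp del: upt_Suc)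
  then show "i \<in> {1..r} \<Longrightarrow> part_size lam i = L i" .
  have cnt: "count_list (concat (map (\<lambda>i. replicate (m i) (L i)) [1..<k + 1])) (L i)
             = (if i \<le> k then m i else 0)" if "k \<le> r" "i \<in> {1..r}" for k i
    using that(1)
  proof (induction k)
    case (Suc k)
    have rep: "count_list (replicate n x) y = (if x = y then n else 0)" for n and x y :: nat
      by (induction n) auto
    have "L (Suc k) = L i \<longleftrightarrow> Suc k = i" using inj Suc.prems that(2) by simp
    then show ?case using Suc that(2)
      by (auto simp: rep simp del: upt_Suc simp add: upt_Suc_append)
  qed (use that(2) in simp)
  show "multiplicity_of lam i = m i" if i: "i \<in> {1..r}"
  proof -
    have "lam = concat (map (\<lambda>i. replicate (m i) (L i)) [1..<r + 1])"
      using assms unfolding compressed_form_def by blast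
    then show ?thesis
      unfolding multiplicity_of_def p[OF i] using cnt[OF order_refl i] i by simp
  qed
qed

lemma ex_compressed_form:
  assumes "is_partition lam"
  shows "\<exists>r L m. compressed_form lam r L m"
  using assms
proof (induction lam rule: rev_induct)
  case Nil
  have "compressed_form [] 0 id id" by (simp add: compressed_form_def)
  then show ?case by blast
next
  case (snoc x xs)
  then have "is_partition xs" and x: "x > 0" "\<forall>y\<in>set xs. y \<ge> x"
    by (auto simp: is_partition_def sorted_wrt_append)
  with snoc.IH obtain r L m where c: "compressed_form xs r L m" by blast
  then have xs: "xs = concat (map (\<lambda>i. replicate (m i) (L i)) [1..<r + 1])"
    unfolding compressed_form_def by blast
  show ?case
  proof (cases "r > 0 \<and> L r = x")
    case True
    let ?m = "m(r := Suc (m r))"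
    have upt: "[1..<r + 1] = [1..<r] @ [r]" using True by simp
    have "map (\<lambda>i. replicate (?m i) (L i)) [1..<r] = map (\<lambda>i. replicate (m i) (L i)) [1..<r]"
      by (rule map_cong) auto
    moreover have "replicate (m r) (L r) @ [x] = replicate (?m r) (L r)"
      using True by (simp add: replicate_append_same)
    ultimately have "xs @ [x] = concat (map (\<lambda>i. replicate (?m i) (L i)) [1..<r + 1])"
      unfolding xs upt
      by (simp only: map_append concat_append append_assoc list.map concat.simps append_Nil2)
    then have "compressed_form (xs @ [x]) r L ?m"
      using c unfolding compressed_form_def by auto
    then show ?thesis by blast
  next
    case False
    have lt: "L r > x" if "r > 0"
    proof -
      have "L r \<in> set xs" using set_compressed_form[OF c] that by auto
      then show ?thesis using x False that by fastforce
    qed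
    let ?m = "m(Suc r := 1)" and ?L = "L(Suc r := x)"
    have upt: "[1..<Suc r + 1] = [1..<r + 1] @ [Suc r]" by simp
    have "map (\<lambda>i. replicate (?m i) (?L i)) [1..<r + 1]
        = map (\<lambda>i. replicate (m i) (L i)) [1..<r + 1]"
      by (rule map_cong) auto
    moreover have "[x] = replicate (?m (Suc r)) (?L (Suc r))" by simp
    ultimately have "xs @ [x] = concat (map (\<lambda>i. replicate (?m i) (?L i)) [1..<Suc r + 1])"
      unfolding xs upt
      by (simp only: map_append concat_append append_assoc list.map concat.simps append_Nil2)
    moreover have "\<forall>i\<in>{1..<Suc r}. ?L i > ?L (i + 1)"
      using c lt by (auto simp: compressed_form_def less_Suc_eq)
    moreover have "\<forall>i\<in>{1..Suc r}. ?L i > 0 \<and> ?m i \<ge> 1"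
      using c x by (auto simp: compressed_form_def)
    ultimately have "compressed_form (xs @ [x]) (Suc r) ?L ?m"
      unfolding compressed_form_def by blast
    then show ?thesis by blast
  qed
qed

lemma compressed_form_canonical:
  assumes "is_partition lam"
  shows "compressed_form lam (num_sizes lam) (part_size lam) (multiplicity_of lam)"
proof -
  obtain r L m where c: "compressed_form lam r L m" using ex_compressed_form[OF assms] by blast
  note u = compressed_form_unique[OF c]
  have LL: "\<forall>i\<in>{1..<r}. L i > L (i + 1)"
    and Lm: "\<forall>i\<in>{1..r}. L i > 0 \<and> m i \<ge> 1"
    and lam: "lam = concat (map (\<lambda>i. replicate (m i) (L i)) [1..<r + 1])"
    using c unfolding compressed_form_def by blast+
  have "map (\<lambda>i. replicate (multiplicity_of lam i) (part_size lam i)) [1..<r + 1]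
      = map (\<lambda>i. replicate (m i) (L i)) [1..<r + 1]"
    by (rule map_cong) (auto simp: u simp del: upt_Suc)
  from trans[OF lam arg_cong[OF this[symmetric], of concat]]
  have "lam = concat (map (\<lambda>i. replicate (multiplicity_of lam i) (part_size lam i)) [1..<r + 1])" .
  moreover have "\<forall>i\<in>{1..<r}. part_size lam i > part_size lam (i + 1)"
    using LL by (auto simp: u)
  moreover have "\<forall>i\<in>{1..r}. part_size lam i > 0 \<and> multiplicity_of lam i \<ge> 1"
    using Lm by (auto simp: u)
  ultimately show ?thesis unfolding compressed_form_def u(1) by blast
qed

end

theory Submission
  imports Defs
begin

text \<open>
  The diagram of \<open>(L\<^sub>1 ^ m\<^sub>1, \<dots>, L\<^sub>r ^ m\<^sub>r)\<close> is the union of the rectangles with \<open>S\<^sub>i\<close> rows and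
  \<open>L\<^sub>i\<close> columns. Transposing exchanges the two families, and since the gaps \<open>g\<^sub>r, \<dots>, g\<^sub>i\<close> add
  up to \<open>L\<^sub>i\<close>, the transposed rectangles are those of \<open>(S\<^sub>r ^ g\<^sub>r, \<dots>, S\<^sub>1 ^ g\<^sub>1)\<close>. A partition is
  determined by its diagram.
\<close>

lemma ferrers_append_replicate:
  "(a, j) \<in> ferrers (xs @ replicate n x) \<longleftrightarrow>
     (a, j) \<in> ferrers xs \<or> length xs \<le> a \<and> a < length xs + n \<and> j < x"
  by (auto simp: ferrers_def nth_append)

text \<open>Induction on the number of blocks. Block \<open>Suc k\<close> contributes only the rows
  below the first \<open>k\<close> blocks; enlarging it to a rectangle that starts at row 0 adds no
  new cell, because the earlier rows are longer.\<close>

lemma ferrers_compressed_form: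
  assumes "compressed_form lam r L m"
  shows "(a, j) \<in> ferrers lam \<longleftrightarrow> (\<exists>i\<in>{1..r}. a < (\<Sum>k=1..i. m k) \<and> j < L i)"
proof -
  let ?xs = "\<lambda>k. concat (map (\<lambda>i. replicate (m i) (L i)) [1..<k + 1])"
  have len: "length (?xs k) = (\<Sum>i=1..k. m i)" for k
    by (induction k) auto
  have "(a, j) \<in> ferrers (?xs k) \<longleftrightarrow> (\<exists>i\<in>{1..k}. a < (\<Sum>k=1..i. m k) \<and> j < L i)"
    if "k \<le> r" for k
    using that
  proof (induction k)
    case 0
    show ?case by (simp add: ferrers_def)
  next
    case (Suc k)
    have step: "?xs (Suc k) = ?xs k @ replicate (m (Suc k)) (L (Suc k))" by simp
    \<comment> \<open>The part of the new rectangle that meets earlier rows already lies in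
      rectangle \<open>k\<close>, since \<open>L (Suc k) < L k\<close>.\<close>
    have corner: "\<exists>i\<in>{1..k}. a < (\<Sum>k=1..i. m k) \<and> j < L i"
      if "a < (\<Sum>i=1..k. m i)" "j < L (Suc k)"
    proof (cases "k = 0")
      case False
      then have "L (Suc k) < L k" using compressed_form_less[OF assms, of k "Suc k"] Suc.prems by simp
      then show ?thesis using that False by (intro bexI[of _ k]) auto
    qed (use that in simp)
    have "(a, j) \<in> ferrers (?xs (Suc k)) \<longleftrightarrow>
        (\<exists>i\<in>{1..k}. a < (\<Sum>k=1..i. m k) \<and> j < L i) \<or>
        (\<Sum>i=1..k. m i) \<le> a \<and> a < (\<Sum>i=1..Suc k. m i) \<and> j < L (Suc k)"
      unfolding step ferrers_append_replicate len using Suc by simp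
    also have "\<dots> \<longleftrightarrow> (\<exists>i\<in>{1..k}. a < (\<Sum>k=1..i. m k) \<and> j < L i) \<or>
        a < (\<Sum>i=1..Suc k. m i) \<and> j < L (Suc k)"
      using corner by (meson not_le)
    also have "\<dots> \<longleftrightarrow> (\<exists>i\<in>{1..Suc k}. a < (\<Sum>k=1..i. m k) \<and> j < L i)"
      by (auto simp: atLeastAtMostSuc_conv)
    finally show ?case .
  qed
  moreover have "lam = ?xs r" using assms unfolding compressed_form_def by blast
  ultimately show ?thesis by blast
qed

lemma conjugate_eqI:
  assumes "is_partition lam" "is_partition mu" "ferrers mu = (ferrers lam)\<inverse>"
  shows "conjugate lam = mu"
  using assms ferrers_inject ferrers_conjugate is_partition_conjugate by simp

lemma gap_pos:
  assumes "compressed_form lam r L m" "i \<in> {1..r}"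
  shows "gap r L i > 0"
  using assms by (auto simp: gap_def compressed_form_def)

text \<open>The sum telescopes upward from the smallest part: its first term is
  \<open>gap r L r = L r\<close>, and each later gap is a difference of neighbouring sizes. As
  \<open>L\<close> decreases, truncated subtraction loses nothing.\<close>

lemma sum_gaps:
  assumes "compressed_form lam r L m" "i \<in> {1..r}"
  shows "(\<Sum>k=1..i. gap r L (r + 1 - k)) = L (r + 1 - i)"
  using assms(2)
proof (induction i)
  case (Suc i)
  show ?case
  proof (cases "i = 0")
    case False
    have "L (r - i) > L (Suc (r - i))"
      using False Suc.prems by (intro compressed_form_less[OF assms(1)]) auto
    moreover have "r - i = Suc (r - Suc i)" "Suc (r - Suc i) < r"
      using False Suc.prems unfolding atLeastAtMost_iff by arith+
    ultimately show ?thesis using False Suc by (simp add: gap_def Suc_diff_le)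
  qed (simp add: gap_def)
qed simp

text \<open>The reversal \<open>r + 1 - i\<close> is an involution of \<open>{1..r}\<close>, so it
  serves as its own inverse in the bijection.\<close>

lemma card_reverse:
  fixes r :: nat
  assumes "\<And>i. i \<in> {1..r} \<Longrightarrow> P i \<longleftrightarrow> Q (r + 1 - i)"
  shows "card {i \<in> {1..r}. P i} = card {i \<in> {1..r}. Q i}"
proof (rule bij_betw_same_card)
  have "Q i \<longleftrightarrow> P (r + 1 - i)" if "i \<in> {1..r}" for i
  proof -
    have "r + 1 - i \<in> {1..r}" "r + 1 - (r + 1 - i) = i" using that by auto
    with assms[of "r + 1 - i"] show ?thesis by (simp del: One_nat_def)
  qed
  then show "bij_betw (\<lambda>i. r + 1 - i) {i \<in> {1..r}. P i} {i \<in> {1..r}. Q i}"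
    using assms by (intro bij_betw_byWitness[where f' = "\<lambda>i. r + 1 - i"]) force+
qed

text \<open>Lets \<open>A\<close> be computed from any given compressed form instead of the
  canonical data. Only values of \<open>L\<close> inside \<open>{1..r}\<close> enter, as
  \<open>gap\<close> reads \<open>L (i + 1)\<close> only when \<open>i < r\<close>.\<close>

lemma A_compressed_form:
  assumes "compressed_form lam r L m"
  shows "A lam = card {i \<in> {1..r}. gap r L i > 1}"
proof -
  have "gap r (part_size lam) i = gap r L i" if "i \<in> {1..r}" for i
    using that compressed_form_unique(2)[OF assms] by (auto simp: gap_def)
  then show ?thesis
    unfolding A_def compressed_form_unique(1)[OF assms] by (metis (no_types, lifting))
qed

lemma B_compressed_form:
  assumes "compressed_form lam r L m"
  shows "B lam = card {i \<in> {1..r}. m i > 1}"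
  unfolding B_def compressed_form_unique(1)[OF assms]
  using compressed_form_unique(3)[OF assms] by (metis (no_types, lifting))

theorem proposition6p5:
  fixes lam :: "nat list" and r :: nat and L m g S :: "nat \<Rightarrow> nat"
  assumes "is_partition lam"
    and "compressed_form lam r L m"
    and "\<And>i. i \<in> {1..r} \<Longrightarrow> g i = gap r L i"
    and "\<And>i. i \<in> {1..r} \<Longrightarrow> S i = (\<Sum>k=1..i. m k)"
  shows "compressed_form (conjugate lam) r (\<lambda>i. S (r + 1 - i)) (\<lambda>i. g (r + 1 - i)) \<and>
         A (conjugate lam) = B lam \<and> B (conjugate lam) = A lam"
proof -
  let ?L = "\<lambda>i. S (r + 1 - i)" and ?m = "\<lambda>i. g (r + 1 - i)"
  define mu where "mu = concat (map (\<lambda>i. replicate (?m i) (?L i)) [1..<r + 1])"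
  have m: "m i \<ge> 1" if "i \<in> {1..r}" for i
    using assms(2) that by (auto simp: compressed_form_def)
  \<comment> \<open>The hypothesis fixes \<open>S\<close> only on \<open>{1..r}\<close>;
    \<open>S 0\<close> may be anything, so the recurrence starts at 1 and \<open>S 1\<close> is
    treated separately.\<close>
  have S_Suc: "S (Suc i) = S i + m (Suc i)" if "i \<in> {1..<r}" for i
    using that by (simp add: assms(4))
  have S_1: "S 1 = m 1" if "r \<ge> 1"
    using that by (simp add: assms(4))
  have S_pos: "S i > 0" if "i \<in> {1..r}" for i
  proof -
    have "m i \<le> S i" unfolding assms(4)[OF that] using that by (intro member_le_sum) auto
    then show ?thesis using m[OF that] by simp
  qed
  \<comment> \<open>For \<open>i < r\<close> this is a difference of consecutive partial sums; for
    \<open>i = r\<close> the gap is the smallest new size, \<open>S 1 = m 1\<close>.\<close>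
  have gap_S: "gap r ?L i = m (r + 1 - i)" if "i \<in> {1..r}" for i
    using that S_Suc[of "r - i"] S_1 by (auto simp: gap_def Suc_diff_le)
  have mu: "compressed_form mu r ?L ?m"
    unfolding compressed_form_def
  proof (intro conjI ballI)
    fix i assume i: "i \<in> {1..<r}"
    have "S (Suc (r - i)) = S (r - i) + m (Suc (r - i))" using i by (intro S_Suc) auto
    moreover have "m (Suc (r - i)) \<ge> 1" using i by (intro m) auto
    ultimately show "?L (i + 1) < ?L i" using i by (simp add: Suc_diff_le)
  next
    fix i assume "i \<in> {1..r}"
    then have i: "r + 1 - i \<in> {1..r}" by auto
    show "?L i > 0" using S_pos[OF i] .
    show "?m i \<ge> 1" using gap_pos[OF assms(2) i] assms(3)[OF i] by simp
  qed (simp add: mu_def)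
  have sum_m: "(\<Sum>k=1..i. ?m k) = L (r + 1 - i)" if "i \<in> {1..r}" for i
  proof -
    have "(\<Sum>k=1..i. ?m k) = (\<Sum>k=1..i. gap r L (r + 1 - k))"
      using that by (intro sum.cong refl assms(3)) auto
    then show ?thesis using sum_gaps[OF assms(2) that] by simp
  qed
  have "(j, a) \<in> ferrers mu \<longleftrightarrow> (a, j) \<in> ferrers lam" for a j
  proof -
    \<comment> \<open>By \<open>sum_m\<close>, rectangle \<open>i\<close> of \<open>mu\<close> is
      the transpose of rectangle \<open>r + 1 - i\<close> of \<open>lam\<close>; it remains to
      reindex the union.\<close>
    have "(j, a) \<in> ferrers mu \<longleftrightarrow> (\<exists>i\<in>{1..r}. j < L (r + 1 - i) \<and> a < S (r + 1 - i))"
      unfolding ferrers_compressed_form[OF mu] using sum_m by (intro bex_cong) auto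
    also have "\<dots> \<longleftrightarrow> (\<exists>i\<in>(\<lambda>i. r + 1 - i) ` {1..r}. j < L i \<and> a < S i)" by blast
    also have "(\<lambda>i. r + 1 - i) ` {1..r} = {1..r}"
      by (rule bij_betw_imp_surj_on, rule bij_betw_byWitness[where f' = "\<lambda>i. r + 1 - i"]) auto
    also have "(\<exists>i\<in>{1..r}. j < L i \<and> a < S i) \<longleftrightarrow> (a, j) \<in> ferrers lam"
      unfolding ferrers_compressed_form[OF assms(2)] using assms(4) by (intro bex_cong) auto
    finally show ?thesis .
  qed
  then have "ferrers mu = (ferrers lam)\<inverse>" by auto
  then have conj: "conjugate lam = mu"
    using assms(1) is_partition_compressed_form[OF mu] by (intro conjugate_eqI)
  have "A mu = B lam"
    unfolding A_compressed_form[OF mu] B_compressed_form[OF assms(2)]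
    using gap_S by (intro card_reverse) auto
  moreover have "B mu = A lam"
    unfolding B_compressed_form[OF mu] A_compressed_form[OF assms(2)]
    by (rule card_reverse) (subst assms(3), auto)
  ultimately show ?thesis using mu conj by simp
qed

end
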